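(* For $i\in\{1,2,3\}$ and $N\in\mathbb N$ the following sum is orthogonal (with respect to $\langle\,,\,\rangle$) and direct: $$P_N=R_i(P_{N-2})+{\rm Ker}(L_i)\cap P_N .$$
   Context: $\mathbb N=\{0,1,2,\ldots\}$. $P=\mathbb C[x,y,z,w]$; $P_N$ is the subspace of homogeneous polynomials of total degree $N$, and $P_{-1}=P_{-2}=0$. $P$ is endowed with the Hermitian form (linear in the first argument, conjugate-symmetric) for which the monomials $x^ry^sz^tw^u$ $(r,s,t,u\in\mathbb N)$ are mutually orthogonal with $\langle x^ry^sz^tw^u,x^ry^sz^tw^u\rangle=r!s!t!u!$. With $D_x,D_y,D_z,D_w$ the partial derivatives, define $L_i,R_i\in{\rm End}(P)$ by $L_1=D_xD_y-D_zD_w$, $L_2=D_xD_z-D_wD_y$, $L_3=D_xD_w-D_yD_z$; $R_1(f)=(xy-zw)f$, $R_2(f)=(xz-wy)f$, $R_3(f)=(xw-yz)f$. *)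

theory Defs
  imports Complex_Main "HOL-Library.Poly_Mapping" "HOL-Library.Product_Plus"
    "HOL-Library.Set_Algebras"
begin

text \<open>
  The polynomial ring in four variables x, y, z, w over the complex numbers, as the monoid
  algebra of exponent vectors: the key \<open>(r, s, t, u)\<close> stands for the monomial
  \<open>x^r y^s z^t w^u\<close>, and multiplication is the convolution product of
  \<^theory>\<open>HOL-Library.Poly_Mapping\<close>.
\<close>

type_synonym expo = "nat \<times> nat \<times> nat \<times> nat"
type_synonym cpoly = "expo \<Rightarrow>\<^sub>0 complex"

definition X :: cpoly where "X = Poly_Mapping.single (1, 0, 0, 0) 1"
definition Y :: cpoly where "Y = Poly_Mapping.single (0, 1, 0, 0) 1"
definition Z :: cpoly where "Z = Poly_Mapping.single (0, 0, 1, 0) 1"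
definition W :: cpoly where "W = Poly_Mapping.single (0, 0, 0, 1) 1"

text \<open>
  The degree is an integer, so that the spaces of negative degree are zero
  (see \<open>homog_neg\<close> below).
\<close>

definition homog :: "int \<Rightarrow> cpoly set" where
  "homog n = {f. \<forall>(r, s, t, u) \<in> Poly_Mapping.keys f. int (r + s + t + u) = n}"

text \<open>
  Partial derivatives, term by term. Where the truncated subtraction would matter, the
  coefficient is zero.
\<close>

definition Dx :: "cpoly \<Rightarrow> cpoly" where
  "Dx f = (\<Sum>(r, s, t, u) \<in> Poly_Mapping.keys f.
     Poly_Mapping.single (r - 1, s, t, u) (of_nat r * Poly_Mapping.lookup f (r, s, t, u)))"

definition Dy :: "cpoly \<Rightarrow> cpoly" where
  "Dy f = (\<Sum>(r, s, t, u) \<in> Poly_Mapping.keys f.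
     Poly_Mapping.single (r, s - 1, t, u) (of_nat s * Poly_Mapping.lookup f (r, s, t, u)))"

definition Dz :: "cpoly \<Rightarrow> cpoly" where
  "Dz f = (\<Sum>(r, s, t, u) \<in> Poly_Mapping.keys f.
     Poly_Mapping.single (r, s, t - 1, u) (of_nat t * Poly_Mapping.lookup f (r, s, t, u)))"

definition Dw :: "cpoly \<Rightarrow> cpoly" where
  "Dw f = (\<Sum>(r, s, t, u) \<in> Poly_Mapping.keys f.
     Poly_Mapping.single (r, s, t, u - 1) (of_nat u * Poly_Mapping.lookup f (r, s, t, u)))"

text \<open>
  The Hermitian form, linear in the first argument, expanded in the orthogonal basis of
  monomials; monomials outside the support of \<open>f\<close> contribute zero.
\<close>

definition herm :: "cpoly \<Rightarrow> cpoly \<Rightarrow> complex" where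
  "herm f g = (\<Sum>(r, s, t, u) \<in> Poly_Mapping.keys f.
     Poly_Mapping.lookup f (r, s, t, u) * cnj (Poly_Mapping.lookup g (r, s, t, u)) *
     (fact r * fact s * fact t * fact u))"

text \<open>The operators are only meant for indices 1, 2, 3.\<close>

definition L :: "nat \<Rightarrow> cpoly \<Rightarrow> cpoly" where
  "L i f =
    (if i = 1 then Dx (Dy f) - Dz (Dw f)
     else if i = 2 then Dx (Dz f) - Dw (Dy f)
     else Dx (Dw f) - Dy (Dz f))"

definition R :: "nat \<Rightarrow> cpoly \<Rightarrow> cpoly" where
  "R i f =
    (if i = 1 then (X * Y - Z * W) * f
     else if i = 2 then (X * Z - W * Y) * f
     else (X * W - Y * Z) * f)"

definition Ker :: "(cpoly \<Rightarrow> cpoly) \<Rightarrow> cpoly set" where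
  "Ker T = {f. T f = 0}"

text \<open>
  The sum of two subspaces is direct if each of its elements has only one decomposition.
\<close>

definition direct_sum :: "cpoly set \<Rightarrow> cpoly set \<Rightarrow> bool" where
  "direct_sum U V \<longleftrightarrow>
    (\<forall>u\<in>U. \<forall>u'\<in>U. \<forall>v\<in>V. \<forall>v'\<in>V. u + v = u' + v' \<longrightarrow> u = u' \<and> v = v')"

definition orthogonal_sum :: "cpoly set \<Rightarrow> cpoly set \<Rightarrow> bool" where
  "orthogonal_sum U V \<longleftrightarrow> (\<forall>u\<in>U. \<forall>v\<in>V. herm u v = 0)"

lemma homog_neg: "n < 0 \<Longrightarrow> homog n = {0}"
proof -
  assume n: "n < 0"
  have "f = 0" if "f \<in> homog n" for f
  proof (rule ccontr)
    assume "f \<noteq> 0"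
    then obtain r s t u where "(r, s, t, u) \<in> Poly_Mapping.keys f"
      by (metis keys_eq_empty ex_in_conv prod_cases4)
    with that n show False
      by (force simp: homog_def)
  qed
  moreover have "0 \<in> homog n"
    by (simp add: homog_def)
  ultimately show ?thesis
    by blast
qed

lemma herm_monomials:
  "herm (Poly_Mapping.single (r, s, t, u) 1) (Poly_Mapping.single (r', s', t', u') 1) =
    (if (r, s, t, u) = (r', s', t', u') then fact r * fact s * fact t * fact u else 0)"
  by (auto simp: herm_def lookup_single)

lemma monomial_eq:
  "Poly_Mapping.single (r, s, t, u) 1 = X ^ r * Y ^ s * Z ^ t * W ^ u"
proof -
  have "X ^ r = Poly_Mapping.single (r, 0, 0, 0) 1"
    by (induction r) (simp_all add: X_def mult_single zero_prod_def flip: single_one)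
  moreover have "Y ^ s = Poly_Mapping.single (0, s, 0, 0) 1"
    by (induction s) (simp_all add: Y_def mult_single zero_prod_def flip: single_one)
  moreover have "Z ^ t = Poly_Mapping.single (0, 0, t, 0) 1"
    by (induction t) (simp_all add: Z_def mult_single zero_prod_def flip: single_one)
  moreover have "W ^ u = Poly_Mapping.single (0, 0, 0, u) 1"
    by (induction u) (simp_all add: W_def mult_single zero_prod_def flip: single_one)
  ultimately show ?thesis
    by (simp add: mult_single)
qed

end

theory Submission
  imports Defs
begin

text \<open>
  Multiplication by a variable is adjoint to the corresponding partial derivative, so
  \<open>L i\<close> is the adjoint of \<open>R i\<close> for a positive definite form. The kernel of \<open>L i\<close> on
  homogeneous polynomials is therefore the orthogonal complement of the image of \<open>R i\<close>, and
  a finite-dimensional subspace has an orthogonal projection (by Gram--Schmidt).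
\<close>

section \<open>The Hermitian form\<close>

text \<open>The squared norm of a monomial. Being real, it is fixed by conjugation, and its
  positivity can be stated directly.\<close>

definition wt :: "expo \<Rightarrow> real" where
  "wt = (\<lambda>(r, s, t, u). fact r * fact s * fact t * fact u)"

lemma wt_pos: "wt k > 0"
  by (simp add: wt_def split: prod.splits)

text \<open>The defining sum runs over the support of the first argument only. A common finite index
  set for several polynomials makes additivity and conjugate symmetry termwise facts.\<close>

lemma herm_superset:
  assumes "finite S" and "Poly_Mapping.keys f \<subseteq> S"
  shows "herm f g =
    (\<Sum>k\<in>S. Poly_Mapping.lookup f k * cnj (Poly_Mapping.lookup g k) * of_real (wt k))"
proof -
  have "herm f g = (\<Sum>k\<in>Poly_Mapping.keys f.
      Poly_Mapping.lookup f k * cnj (Poly_Mapping.lookup g k) * of_real (wt k))"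
    unfolding herm_def by (rule sum.cong) (auto simp: wt_def)
  also have "\<dots> = (\<Sum>k\<in>S.
      Poly_Mapping.lookup f k * cnj (Poly_Mapping.lookup g k) * of_real (wt k))"
    using assms by (intro sum.mono_neutral_left) (auto simp: in_keys_iff)
  finally show ?thesis .
qed

lemma herm_add_left: "herm (f + f') g = herm f g + herm f' g"
proof -
  let ?S = "Poly_Mapping.keys f \<union> Poly_Mapping.keys f'"
  have "Poly_Mapping.keys (f + f') \<subseteq> ?S"
    by (rule keys_add)
  then show ?thesis
    by (simp add: herm_superset[of ?S] lookup_add algebra_simps sum.distrib)
qed

lemma herm_diff_left: "herm (f - f') g = herm f g - herm f' g"
  using herm_add_left[of "f - f'" f' g] by simp

lemma herm_cnj: "herm g f = cnj (herm f g)"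
proof -
  let ?S = "Poly_Mapping.keys f \<union> Poly_Mapping.keys g"
  show ?thesis
    by (simp add: herm_superset[of ?S] mult.commute)
qed

lemma herm_add_right: "herm f (g + g') = herm f g + herm f g'"
  by (metis herm_cnj herm_add_left complex_cnj_add)

lemma herm_diff_right: "herm f (g - g') = herm f g - herm f g'"
  by (metis herm_cnj herm_diff_left complex_cnj_diff)

lemma herm_zero [simp]: "herm 0 g = 0" "herm f 0 = 0"
  by (simp_all add: herm_def split_beta)

text \<open>Scalars are encoded as constant polynomials \<open>single 0 c\<close>, so that scaling
  is ordinary ring multiplication and \<open>algebra_simps\<close> applies.\<close>

lemma lookup_scale:
  fixes f :: cpoly
  shows "Poly_Mapping.lookup (Poly_Mapping.single 0 c * f) k = c * Poly_Mapping.lookup f k"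
  by (simp flip: mult_map_scale_conv_mult add: Poly_Mapping.map.rep_eq when_def)

lemma herm_scale_left: "herm (Poly_Mapping.single 0 c * f) g = c * herm f g"
proof -
  have "Poly_Mapping.keys (Poly_Mapping.single 0 c * f) \<subseteq> Poly_Mapping.keys f"
    by (auto simp: in_keys_iff lookup_scale)
  then show ?thesis
    by (simp add: herm_superset[of "Poly_Mapping.keys f"] lookup_scale sum_distrib_left mult.assoc)
qed

lemma herm_scale_right: "herm f (Poly_Mapping.single 0 c * g) = cnj c * herm f g"
  by (metis herm_cnj herm_scale_left complex_cnj_mult)

lemma herm_definite:
  assumes "herm f f = 0"
  shows "f = 0"
proof -
  \<comment> \<open>On the diagonal the form is a real sum of weighted squared moduli, so it
    vanishes only if every term does.\<close>
  have "complex_of_real (\<Sum>k\<in>Poly_Mapping.keys f. (cmod (Poly_Mapping.lookup f k))\<^sup>2 * wt k) = herm f f"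
    by (simp add: herm_superset[of "Poly_Mapping.keys f"] complex_norm_square
        del: of_real_power)
  with assms have "(\<Sum>k\<in>Poly_Mapping.keys f. (cmod (Poly_Mapping.lookup f k))\<^sup>2 * wt k) = 0"
    by (simp only: of_real_eq_0_iff)
  then have "\<forall>k\<in>Poly_Mapping.keys f. (cmod (Poly_Mapping.lookup f k))\<^sup>2 * wt k = 0"
    by (subst (asm) sum_nonneg_eq_0_iff) (simp_all add: less_imp_le[OF wt_pos])
  then have "Poly_Mapping.lookup f k = 0" for k
    using wt_pos[of k] by (cases "k \<in> Poly_Mapping.keys f") (auto simp: in_keys_iff)
  then show ?thesis
    by (simp add: poly_mapping_eqI)
qed

lemma herm_single:
  "herm (Poly_Mapping.single k c) g = c * cnj (Poly_Mapping.lookup g k) * of_real (wt k)"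
  by (simp add: herm_superset[of "{k}"])

section \<open>Derivatives as adjoints of multiplication\<close>

text \<open>Serves all four derivatives at once. Truncated subtraction sends the exponents 0 and 1
  both to 0; since the factor \<open>c k\<close> vanishes at exponent 0, injectivity is required
  only where \<open>c k\<close> is nonzero.\<close>

lemma lookup_sum_single:
  fixes f :: cpoly
  assumes "\<And>k. c k \<noteq> 0 \<Longrightarrow> \<phi> k = m \<longleftrightarrow> k = l"
    and "\<phi> l = m"
  shows "Poly_Mapping.lookup (\<Sum>k\<in>Poly_Mapping.keys f.
      Poly_Mapping.single (\<phi> k) (c k * Poly_Mapping.lookup f k)) m = c l * Poly_Mapping.lookup f l"
proof -
  have "Poly_Mapping.lookup (\<Sum>k\<in>Poly_Mapping.keys f.
      Poly_Mapping.single (\<phi> k) (c k * Poly_Mapping.lookup f k)) m =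
      (\<Sum>k\<in>Poly_Mapping.keys f. if k = l then c l * Poly_Mapping.lookup f l else 0)"
    unfolding lookup_sum by (rule sum.cong) (use assms in \<open>auto simp: lookup_single when_def\<close>)
  \<comment> \<open>If \<open>l\<close> lies outside the support, the sum is empty of nonzero terms
    and the coefficient on the right is zero too.\<close>
  also have "\<dots> = c l * Poly_Mapping.lookup f l"
    by (simp add: in_keys_iff)
  finally show ?thesis .
qed

lemma lookup_Dx:
  "Poly_Mapping.lookup (Dx f) (r, s, t, u) = of_nat (Suc r) * Poly_Mapping.lookup f (Suc r, s, t, u)"
  using lookup_sum_single[of "\<lambda>(r, s, t, u). of_nat r" "\<lambda>(r, s, t, u). (r - 1, s, t, u)"
      "(r, s, t, u)" "(Suc r, s, t, u)" f]
  by (fastforce simp: Dx_def split_beta)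

lemma lookup_Dy:
  "Poly_Mapping.lookup (Dy f) (r, s, t, u) = of_nat (Suc s) * Poly_Mapping.lookup f (r, Suc s, t, u)"
  using lookup_sum_single[of "\<lambda>(r, s, t, u). of_nat s" "\<lambda>(r, s, t, u). (r, s - 1, t, u)"
      "(r, s, t, u)" "(r, Suc s, t, u)" f]
  by (fastforce simp: Dy_def split_beta)

lemma lookup_Dz:
  "Poly_Mapping.lookup (Dz f) (r, s, t, u) = of_nat (Suc t) * Poly_Mapping.lookup f (r, s, Suc t, u)"
  using lookup_sum_single[of "\<lambda>(r, s, t, u). of_nat t" "\<lambda>(r, s, t, u). (r, s, t - 1, u)"
      "(r, s, t, u)" "(r, s, Suc t, u)" f]
  by (fastforce simp: Dz_def split_beta)

lemma lookup_Dw: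
  "Poly_Mapping.lookup (Dw f) (r, s, t, u) = of_nat (Suc u) * Poly_Mapping.lookup f (r, s, t, Suc u)"
  using lookup_sum_single[of "\<lambda>(r, s, t, u). of_nat u" "\<lambda>(r, s, t, u). (r, s, t, u - 1)"
      "(r, s, t, u)" "(r, s, t, Suc u)" f]
  by (fastforce simp: Dw_def split_beta)

lemmas lookup_D = lookup_Dx lookup_Dy lookup_Dz lookup_Dw

lemma cpoly_eq_sum_single:
  "f = (\<Sum>k\<in>Poly_Mapping.keys f. Poly_Mapping.single k (Poly_Mapping.lookup f k))"
  for f :: cpoly
  by (rule poly_mapping_eqI) (simp add: lookup_sum lookup_single when_def in_keys_iff)

lemma herm_sum_left: "herm (\<Sum>k\<in>A. F k) g = (\<Sum>k\<in>A. herm (F k) g)"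
  by (induction A rule: infinite_finite_induct) (simp_all add: herm_add_left)

text \<open>Both sides are additive in \<open>f\<close>, so an adjointness relation has to be
  checked on single terms only.\<close>

lemma adjointI:
  assumes "\<And>k c. herm (p * Poly_Mapping.single k c) g = herm (Poly_Mapping.single k c) h"
  shows "herm (p * f) g = herm f h"
proof -
  have "herm (p * f) g = (\<Sum>k\<in>Poly_Mapping.keys f.
      herm (p * Poly_Mapping.single k (Poly_Mapping.lookup f k)) g)"
    by (subst cpoly_eq_sum_single[of f]) (simp only: sum_distrib_left herm_sum_left)
  also have "\<dots> = herm (\<Sum>k\<in>Poly_Mapping.keys f.
      Poly_Mapping.single k (Poly_Mapping.lookup f k)) h"
    by (simp only: assms herm_sum_left)
  also have "\<dots> = herm f h"
    by (simp flip: cpoly_eq_sum_single)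
  finally show ?thesis .
qed

text \<open>Raising the exponent \<open>r\<close> by one multiplies the weight by
  \<open>Suc r\<close>, which is exactly the factor that differentiation produces.\<close>

lemma herm_X: "herm (X * f) g = herm f (Dx g)"
  by (rule adjointI) (auto simp: X_def mult_single herm_single lookup_Dx wt_def)

lemma herm_Y: "herm (Y * f) g = herm f (Dy g)"
  by (rule adjointI) (auto simp: Y_def mult_single herm_single lookup_Dy wt_def)

lemma herm_Z: "herm (Z * f) g = herm f (Dz g)"
  by (rule adjointI) (auto simp: Z_def mult_single herm_single lookup_Dz wt_def)

lemma herm_W: "herm (W * f) g = herm f (Dw g)"
  by (rule adjointI) (auto simp: W_def mult_single herm_single lookup_Dw wt_def)

definition quadric :: "nat \<Rightarrow> cpoly" where
  "quadric i = (if i = 1 then X * Y - Z * W else if i = 2 then X * Z - W * Y else X * W - Y * Z)"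

lemma R_eq: "R i f = quadric i * f"
  by (simp add: R_def quadric_def)

lemma herm_R: "herm (R i f) g = herm f (L i g)"
proof -
  \<comment> \<open>Moving the derivatives across one by one yields the variables in reverse order;
    commutativity of multiplication restores it.\<close>
  have 1: "herm (X * Y * f) g = herm f (Dx (Dy g))" "herm (Z * W * f) g = herm f (Dz (Dw g))"
    "herm (X * Z * f) g = herm f (Dx (Dz g))" "herm (W * Y * f) g = herm f (Dw (Dy g))"
    "herm (X * W * f) g = herm f (Dx (Dw g))" "herm (Y * Z * f) g = herm f (Dy (Dz g))"
    by (simp_all flip: herm_X herm_Y herm_Z herm_W add: mult.left_commute mult.assoc)
  show ?thesis
    by (simp add: R_def L_def left_diff_distrib herm_diff_left herm_diff_right 1)
qed

lemma L_diff: "L i (f - g) = L i f - L i g"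
proof -
  have "Dx (f - g) = Dx f - Dx g" "Dy (f - g) = Dy f - Dy g"
    "Dz (f - g) = Dz f - Dz g" "Dw (f - g) = Dw f - Dw g" for f g
    by (rule poly_mapping_eqI; auto simp: lookup_D lookup_minus right_diff_distrib)+
  then show ?thesis
    by (simp add: L_def)
qed

section \<open>Homogeneous components\<close>

lemma homogI:
  assumes "\<And>r s t u. Poly_Mapping.lookup f (r, s, t, u) \<noteq> 0 \<Longrightarrow> int (r + s + t + u) = n"
  shows "f \<in> homog n"
  using assms by (auto simp: homog_def in_keys_iff)

lemma homogD:
  assumes "f \<in> homog n" and "Poly_Mapping.lookup f (r, s, t, u) \<noteq> 0"
  shows "int (r + s + t + u) = n"
proof -
  have "(r, s, t, u) \<in> Poly_Mapping.keys f"
    using assms(2) by (simp only: in_keys_iff not_False_eq_True)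
  with assms(1) show ?thesis
    unfolding homog_def by blast
qed

text \<open>Turns homogeneity into a support condition on a finite set, which is the form of finite
  dimensionality used for the projection.\<close>

definition degree_keys :: "int \<Rightarrow> expo set" where
  "degree_keys n = {(r, s, t, u). int (r + s + t + u) = n}"

lemma finite_degree_keys: "finite (degree_keys n)"
proof (rule finite_subset)
  show "degree_keys n \<subseteq> {..nat n} \<times> {..nat n} \<times> {..nat n} \<times> {..nat n}"
    by (auto simp: degree_keys_def)
qed simp

lemma homog_eq: "homog n = {f. Poly_Mapping.keys f \<subseteq> degree_keys n}"
  by (simp add: homog_def degree_keys_def subset_eq)

lemma homog_add: "f \<in> homog n \<Longrightarrow> g \<in> homog n \<Longrightarrow> f + g \<in> homog n"
  unfolding homog_eq using keys_add[of f g] by blast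

lemma homog_diff: "f \<in> homog n \<Longrightarrow> g \<in> homog n \<Longrightarrow> f - g \<in> homog n"
  unfolding homog_eq using keys_diff[of f g] by blast

lemma homog_mult:
  assumes "f \<in> homog m" and "g \<in> homog n"
  shows "f * g \<in> homog (m + n)"
proof -
  have "int (r + s + t + u) = m + n" if k_fg: "(r, s, t, u) \<in> Poly_Mapping.keys (f * g)" for r s t u
  proof -
    obtain k l where k: "k \<in> Poly_Mapping.keys f" and l: "l \<in> Poly_Mapping.keys g"
      and eq: "(r, s, t, u) = k + l"
      using k_fg keys_mult[of f g] by blast
    obtain r1 s1 t1 u1 r2 s2 t2 u2 where kl: "k = (r1, s1, t1, u1)" "l = (r2, s2, t2, u2)"
      by (metis prod_cases4)
    have "int (r1 + s1 + t1 + u1) = m" "int (r2 + s2 + t2 + u2) = n"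
      using assms k l unfolding homog_def kl by blast+
    with eq show ?thesis
      by (simp add: kl)
  qed
  then show ?thesis
    unfolding homog_def by blast
qed

lemma quadric_homog: "quadric i \<in> homog 2"
proof -
  have "X \<in> homog 1" "Y \<in> homog 1" "Z \<in> homog 1" "W \<in> homog 1"
    by (auto simp: homog_def X_def Y_def Z_def W_def)
  then show ?thesis
    using homog_mult[of _ 1 _ 1] by (auto simp: quadric_def intro!: homog_diff)
qed

lemma R_homog: "f \<in> homog (n - 2) \<Longrightarrow> R i f \<in> homog n"
  using homog_mult[OF quadric_homog, of f "n - 2" i] by (simp add: R_eq)

lemma D_homog:
  assumes "f \<in> homog n"
  shows "Dx f \<in> homog (n - 1)" "Dy f \<in> homog (n - 1)" "Dz f \<in> homog (n - 1)"
    "Dw f \<in> homog (n - 1)"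
proof -
  \<comment> \<open>A nonzero coefficient of a derivative comes from a nonzero coefficient of
    \<open>f\<close> whose exponents have total degree one higher.\<close>
  have *: "g \<in> homog (n - 1)"
    if "\<And>r s t u. Poly_Mapping.lookup g (r, s, t, u) \<noteq> 0 \<Longrightarrow>
      \<exists>r' s' t' u'. Poly_Mapping.lookup f (r', s', t', u') \<noteq> 0 \<and> r' + s' + t' + u' = Suc (r + s + t + u)"
    for g
  proof (rule homogI)
    fix r s t u
    assume "Poly_Mapping.lookup g (r, s, t, u) \<noteq> 0"
    from that[OF this] obtain r' s' t' u'
      where "Poly_Mapping.lookup f (r', s', t', u') \<noteq> 0" "r' + s' + t' + u' = Suc (r + s + t + u)"
      by blast
    with homogD[OF assms this(1)] show "int (r + s + t + u) = n - 1"
      by linarith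
  qed
  show "Dx f \<in> homog (n - 1)"
    by (rule *) (metis lookup_Dx mult_zero_right add_Suc)
  show "Dy f \<in> homog (n - 1)"
    by (rule *) (metis lookup_Dy mult_zero_right add_Suc add_Suc_right)
  show "Dz f \<in> homog (n - 1)"
    by (rule *) (metis lookup_Dz mult_zero_right add_Suc add_Suc_right)
  show "Dw f \<in> homog (n - 1)"
    by (rule *) (metis lookup_Dw mult_zero_right add_Suc_right)
qed

lemma L_homog:
  assumes "f \<in> homog n"
  shows "L i f \<in> homog (n - 2)"
proof -
  have "L i f \<in> homog (n - 1 - 1)"
    unfolding L_def by (simp only: homog_diff D_homog assms simp_thms split: if_split)
  then show ?thesis
    by simp
qed

section \<open>Orthogonal projection\<close>

text \<open>
  One Gram--Schmidt step: \<open>b\<close> is the component of \<open>p * x^k\<close> orthogonal to the multiples of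
  \<open>p\<close> with keys in \<open>K\<close>. When \<open>b = 0\<close>, the value of \<open>a\<close> is irrelevant.
\<close>

lemma multiples_projection:
  assumes "finite K"
  shows "\<exists>g. Poly_Mapping.keys g \<subseteq> K \<and>
    (\<forall>h. Poly_Mapping.keys h \<subseteq> K \<longrightarrow> herm (f - p * g) (p * h) = 0)"
  using assms
\<comment> \<open>\<open>f\<close> must vary: the hypothesis is used both for \<open>f\<close>
  itself and for \<open>p * ?m\<close>.\<close>
proof (induction K arbitrary: f rule: finite_induct)
  case empty
  show ?case by auto
next
  case (insert k K)
  let ?C = "\<lambda>c. Poly_Mapping.single 0 c :: cpoly"
  let ?m = "Poly_Mapping.single k 1 :: cpoly"
  obtain g0 where g0: "Poly_Mapping.keys g0 \<subseteq> K"
    "\<And>h. Poly_Mapping.keys h \<subseteq> K \<Longrightarrow> herm (f - p * g0) (p * h) = 0"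
    using insert.IH[of f] by blast
  obtain g1 where g1: "Poly_Mapping.keys g1 \<subseteq> K"
    "\<And>h. Poly_Mapping.keys h \<subseteq> K \<Longrightarrow> herm (p * ?m - p * g1) (p * h) = 0"
    using insert.IH[of "p * ?m"] by blast
  define b where "b = p * (?m - g1)"
  define f' where "f' = f - p * g0"
  \<comment> \<open>The Fourier coefficient of \<open>f'\<close> along \<open>b\<close>.\<close>
  define a where "a = herm f' b / herm b b"
  define g where "g = g0 + ?C a * (?m - g1)"
  have fg: "f - p * g = f' - ?C a * b"
    by (simp add: g_def f'_def b_def algebra_simps)
  have orth_b: "herm (f - p * g) b = 0"
    using herm_definite[of b] by (cases "b = 0") (auto simp: fg herm_diff_left herm_scale_left a_def)
  \<comment> \<open>Both \<open>f'\<close> and \<open>b\<close> are orthogonal to the multiples of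
    \<open>p\<close> with keys in \<open>K\<close>, hence so is
    \<open>f' - ?C a * b\<close>.\<close>
  have orth_K: "herm (f - p * g) (p * h) = 0" if "Poly_Mapping.keys h \<subseteq> K" for h
    using g0(2)[OF that] g1(2)[OF that]
    by (simp add: fg herm_diff_left herm_scale_left f'_def b_def right_diff_distrib)
  have zero: "Poly_Mapping.lookup g0 x = 0" "Poly_Mapping.lookup g1 x = 0" if "x \<notin> K" for x
    using that g0(1) g1(1) by (auto simp: in_keys_iff)
  have "Poly_Mapping.lookup g x = 0" if "x \<notin> insert k K" for x
    using that by (auto simp: g_def lookup_add lookup_minus lookup_scale lookup_single when_def zero)
  then have "Poly_Mapping.keys g \<subseteq> insert k K"
    by (metis in_keys_iff subsetI)
  moreover have "herm (f - p * g) (p * h) = 0" if h: "Poly_Mapping.keys h \<subseteq> insert k K" for h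
  proof -
    define c where "c = Poly_Mapping.lookup h k"
    \<comment> \<open>Subtracting \<open>c\<close> times \<open>?m - g1\<close> cancels the
      coefficient at \<open>k\<close>, because \<open>g1\<close> has none there. Thus
      \<open>p * h\<close> splits into a multiple of \<open>p\<close> with keys in \<open>K\<close>
      and a multiple of \<open>b\<close>.\<close>
    define h' where "h' = h - ?C c * (?m - g1)"
    have "Poly_Mapping.lookup h' x = 0" if "x \<notin> K" for x
    proof (cases "x = k")
      case False
      with that h have "Poly_Mapping.lookup h x = 0"
        by (auto simp: in_keys_iff)
      with that False show ?thesis
        by (simp add: h'_def lookup_minus lookup_scale lookup_single when_def zero)
    qed (simp add: h'_def c_def lookup_minus lookup_scale zero[OF insert.hyps(2)])
    then have "Poly_Mapping.keys h' \<subseteq> K"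
      by (metis in_keys_iff subsetI)
    moreover have "p * h = p * h' + ?C c * b"
      by (simp add: h'_def b_def algebra_simps)
    ultimately show ?thesis
      by (simp add: herm_add_right herm_scale_right orth_b orth_K)
  qed
  ultimately show ?case
    by blast
qed

text \<open>Projecting \<open>f\<close> onto the image of \<open>R i\<close> leaves a remainder
  orthogonal to that image. By adjointness, \<open>L i\<close> of the remainder is orthogonal to all
  of \<open>homog (n - 2)\<close>, a space that contains it.\<close>

lemma homog_decomposition:
  assumes "f \<in> homog n"
  shows "\<exists>g\<in>homog (n - 2). f - R i g \<in> Ker (L i) \<inter> homog n"
proof -
  obtain g where g: "g \<in> homog (n - 2)"
    and orth: "\<And>h. h \<in> homog (n - 2) \<Longrightarrow> herm (f - R i g) (R i h) = 0"
    using multiples_projection[OF finite_degree_keys, of "n - 2" f "quadric i"]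
    by (auto simp: homog_eq R_eq)
  have v: "f - R i g \<in> homog n"
    using assms g by (intro homog_diff R_homog)
  \<comment> \<open>The test polynomial \<open>h\<close> is \<open>L i (f - R i g)\<close> itself;
    conjugate symmetry brings \<open>R i h\<close> into the first slot, where \<open>herm_R\<close>
    applies.\<close>
  have "herm (L i (f - R i g)) (L i (f - R i g)) = 0"
    using orth[OF L_homog[OF v]] by (metis herm_R herm_cnj complex_cnj_zero)
  then have "L i (f - R i g) = 0"
    by (rule herm_definite)
  with v g show ?thesis
    by (auto simp: Ker_def)
qed

lemma herm_R_Ker: "v \<in> Ker (L i) \<Longrightarrow> herm (R i g) v = 0"
  by (simp add: herm_R Ker_def)

theorem proposition12p21:
  fixes i N :: nat
  assumes "i \<in> {1, 2, 3}"
  shows "homog (int N) = R i ` homog (int N - 2) + (Ker (L i) \<inter> homog (int N))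
    \<and> orthogonal_sum (R i ` homog (int N - 2)) (Ker (L i) \<inter> homog (int N))
    \<and> direct_sum (R i ` homog (int N - 2)) (Ker (L i) \<inter> homog (int N))"
proof (intro conjI)
  show "homog (int N) = R i ` homog (int N - 2) + (Ker (L i) \<inter> homog (int N))"
  proof (intro equalityI subsetI)
    fix f assume "f \<in> homog (int N)"
    then obtain g where "g \<in> homog (int N - 2)" "f - R i g \<in> Ker (L i) \<inter> homog (int N)"
      using homog_decomposition by blast
    then show "f \<in> R i ` homog (int N - 2) + (Ker (L i) \<inter> homog (int N))"
      using set_plus_intro[of "R i g" _ "f - R i g"] by auto
  next
    fix f assume "f \<in> R i ` homog (int N - 2) + (Ker (L i) \<inter> homog (int N))"
    then show "f \<in> homog (int N)"
      by (auto elim!: set_plus_elim intro: homog_add R_homog)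
  qed
  show "orthogonal_sum (R i ` homog (int N - 2)) (Ker (L i) \<inter> homog (int N))"
    by (auto simp: orthogonal_sum_def herm_R_Ker)
  show "direct_sum (R i ` homog (int N - 2)) (Ker (L i) \<inter> homog (int N))"
    unfolding direct_sum_def
  proof (intro ballI impI)
    fix u u' v v'
    assume "u \<in> R i ` homog (int N - 2)" "u' \<in> R i ` homog (int N - 2)"
      and v: "v \<in> Ker (L i) \<inter> homog (int N)" "v' \<in> Ker (L i) \<inter> homog (int N)"
      and eq: "u + v = u' + v'"
    then obtain g g' where u: "u = R i g" "u' = R i g'"
      by blast
    \<comment> \<open>The difference of the two decompositions lies both in the image of
      \<open>R i\<close> and in the kernel of \<open>L i\<close>, so it is orthogonal to
      itself.\<close>
    have "v' - v = R i (g - g')"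
      using eq by (simp add: u R_eq algebra_simps)
    moreover have "v' - v \<in> Ker (L i)"
      using v by (simp add: Ker_def L_diff)
    ultimately have "v' - v = 0"
      by (metis herm_R_Ker herm_definite)
    with eq show "u = u' \<and> v = v'"
      by simp
  qed
qed

end
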